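(* Consider the OFDM system with channel $h_\tau(\mathbf{t},\mathbf{r})$, $1\le\tau\le T$, channel frequency response $c_m(\mathbf{t},\mathbf{r})$, $1\le m\le M$, and achievable rate $R(\mathbf{t},\mathbf{r},\mathbf{p})$ defined in the context. Suppose that the vector $\bm{\vartheta}=[\hat\vartheta_1^1,\dots,\hat\vartheta_1^{L_1},\dots,\hat\vartheta_T^1,\dots,\hat\vartheta_T^{L_T}]^{\mathrm T}$ satisfies the LIA condition, and that the ALR assumption holds, i.e., $\mathcal{C}_{\mathrm t}=\mathbb{R}\times[y_{\mathrm t}^{\min},y_{\mathrm t}^{\max}]\times[z_{\mathrm t}^{\min},z_{\mathrm t}^{\max}]$. Let $G=\sum_{\tau=1}^{T}\|\mathbf{b}_\tau\|_1^2$. Then in the high-SNR regime the achievable rate is upper-bounded as follows: there exists $\sigma_0^2>0$ such that for every noise power $\sigma^2$ with $0<\sigma^2\le\sigma_0^2$, all $\mathbf{t}\in\mathcal{C}_{\mathrm t}$, all $\mathbf{r}\in\mathcal{C}_{\mathrm r}$, and all power allocations $\mathbf{p}=[p_1,\dots,p_M]^{\mathrm T}\in\mathbb{R}^M$ with $p_m\ge0$ for $1\le m\le M$ and $\sum_{m=1}^{M}p_m\le P$, $$R(\mathbf{t},\mathbf{r},\mathbf{p})\le\bar R=\frac{M}{M+M_{\mathrm{CP}}}\log_2\left(1+\frac{GP}{M\sigma^2}\right).$$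
   Context: Notation: $j$ is the imaginary unit; $\|\cdot\|_1$ is the 1-norm of a complex vector (sum of moduli); $(\cdot)^{\mathrm T}$ and $(\cdot)^{\mathrm H}$ denote transpose and conjugate transpose. Channel model: $\lambda>0$ is the wavelength, $T\ge1$ is the number of delay taps, and $L_\tau\ge1$ is the number of channel paths of tap $\tau$. For each $1\le\tau\le T$, $1\le\ell\le L_\tau$ there are real angles $\hat\theta_\tau^\ell,\hat\phi_\tau^\ell$ (elevation and azimuth angles of departure) and $\tilde\theta_\tau^\ell,\tilde\phi_\tau^\ell$ (elevation and azimuth angles of arrival), and a complex path coefficient $b_\tau^\ell$; put $\mathbf{b}_\tau=[b_\tau^1,\dots,b_\tau^{L_\tau}]^{\mathrm T}$ and $\mathbf{\Sigma}_\tau=\mathrm{diag}\{\mathbf{b}_\tau\}$. Define $$\hat\vartheta_\tau^\ell=\cos\hat\theta_\tau^\ell\cos\hat\phi_\tau^\ell,\quad \hat\varphi_\tau^\ell=\cos\hat\theta_\tau^\ell\sin\hat\phi_\tau^\ell,\quad \hat\omega_\tau^\ell=\sin\hat\theta_\tau^\ell,$$ $$\tilde\vartheta_\tau^\ell=\cos\tilde\theta_\tau^\ell\cos\tilde\phi_\tau^\ell,\quad \tilde\varphi_\tau^\ell=\cos\tilde\theta_\tau^\ell\sin\tilde\phi_\tau^\ell,\quad \tilde\omega_\tau^\ell=\sin\tilde\theta_\tau^\ell,$$ and the wave vectors $\hat{\mathbf{k}}_\tau^\ell=[\hat\vartheta_\tau^\ell,\hat\varphi_\tau^\ell,\hat\omega_\tau^\ell]^{\mathrm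 T}$, $\tilde{\mathbf{k}}_\tau^\ell=[\tilde\vartheta_\tau^\ell,\tilde\varphi_\tau^\ell,\tilde\omega_\tau^\ell]^{\mathrm T}$. For antenna positions $\mathbf{t}=[x_{\mathrm t},y_{\mathrm t},z_{\mathrm t}]^{\mathrm T}\in\mathcal{C}_{\mathrm t}$ and $\mathbf{r}=[x_{\mathrm r},y_{\mathrm r},z_{\mathrm r}]^{\mathrm T}\in\mathcal{C}_{\mathrm r}$ the field-response vectors are $$\mathbf{g}_\tau(\mathbf{t})=\big[e^{j\frac{2\pi}{\lambda}\mathbf{t}^{\mathrm T}\hat{\mathbf{k}}_\tau^1},\dots,e^{j\frac{2\pi}{\lambda}\mathbf{t}^{\mathrm T}\hat{\mathbf{k}}_\tau^{L_\tau}}\big]^{\mathrm T},\qquad \mathbf{f}_\tau(\mathbf{r})=\big[e^{j\frac{2\pi}{\lambda}\mathbf{r}^{\mathrm T}\tilde{\mathbf{k}}_\tau^1},\dots,e^{j\frac{2\pi}{\lambda}\mathbf{r}^{\mathrm T}\tilde{\mathbf{k}}_\tau^{L_\tau}}\big]^{\mathrm T},$$ and the channel impulse response of tap $\tau$ is $h_\tau(\mathbf{t},\mathbf{r})=\mathbf{f}_\tau(\mathbf{r})^{\mathrm H}\mathbf{\Sigma}_\tau\mathbf{g}_\tau(\mathbf{t})$. OFDM: $M\ge T$ is the number of subcarriers, $M_{\mathrm{CP}}\ge T$ is the cyclic prefix length, $P>0$ is the maximum total transmit power, and $\sigma^2>0$ is the noise power per subcarrier. Let $\mathbf{h}(\mathbf{t},\mathbf{r})=[h_1(\mathbf{t},\mathbf{r}),\dots,h_T(\mathbf{t},\mathbf{r}),0,\dots,0]^{\mathrm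 T}\in\mathbb{C}^M$ be the zero-padded impulse response, and let $\mathbf{D}_M$ be the (unnormalized) $M$-dimensional discrete Fourier transform matrix, with entries $e^{-j2\pi(m-1)(n-1)/M}$, $1\le m,n\le M$, so that $\mathbf{D}_M^{\mathrm H}\mathbf{D}_M=M\mathbf{I}_M$. The channel frequency response is $[c_1(\mathbf{t},\mathbf{r}),\dots,c_M(\mathbf{t},\mathbf{r})]^{\mathrm T}=\mathbf{D}_M\mathbf{h}(\mathbf{t},\mathbf{r})$, and the achievable rate is $$R(\mathbf{t},\mathbf{r},\mathbf{p})=\frac{1}{M+M_{\mathrm{CP}}}\sum_{m=1}^{M}\log_2\left(1+\frac{|c_m(\mathbf{t},\mathbf{r})|^2p_m}{\sigma^2}\right).$$ Regions: $\mathcal{C}_{\mathrm t}$ and $\mathcal{C}_{\mathrm r}$ are the regions in which the transmit and receive antennas can move. The receive region is a non-empty cuboid $\mathcal{C}_{\mathrm r}=[x_{\mathrm r}^{\min},x_{\mathrm r}^{\max}]\times[y_{\mathrm r}^{\min},y_{\mathrm r}^{\max}]\times[z_{\mathrm r}^{\min},z_{\mathrm r}^{\max}]$; the transmit region is a non-empty cuboid whose extent along $x_{\mathrm t}$ is arbitrarily large under the ALR (arbitrarily large region) assumption, i.e., $x_{\mathrm t}$ may be any real number, while $y_{\mathrm t}^{\min}\le y_{\mathrm t}^{\max}$ and $z_{\mathrm t}^{\min}\le z_{\mathrm t}^{\max}$ are arbitrary. LIA (linearly independent angle) condition: the $N=\sum_{\tau=1}^T L_\tau$ entries of $\bm{\vartheta}$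 are linearly independent over $\mathbb{Q}$, i.e., $\sum_{\tau=1}^{T}\sum_{\ell=1}^{L_\tau}a_\tau^\ell\hat\vartheta_\tau^\ell\ne0$ for every non-zero rational vector $(a_\tau^\ell)\in\mathbb{Q}^N$. *)

theory Defs
  imports "HOL-Analysis.Euclidean_Space" Jordan_Normal_Form.Matrix
begin

text \<open>
  All indices (taps, paths of a tap, subcarriers) count from 0: tap \<open>\<tau>\<close> ranges over
  \<open>{..<taps ch}\<close> and path \<open>l\<close> of tap \<open>\<tau>\<close> over \<open>{..<paths ch \<tau>}\<close>. Values of the fields
  outside these ranges are never used. Points of three-dimensional space are triples.
\<close>

type_synonym point = "real \<times> real \<times> real"

record channel =
  wavelength :: real
  taps :: nat
  paths :: "nat \<Rightarrow> nat"
  dep_elev :: "nat \<Rightarrow> nat \<Rightarrow> real"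
  dep_azim :: "nat \<Rightarrow> nat \<Rightarrow> real"
  arr_elev :: "nat \<Rightarrow> nat \<Rightarrow> real"
  arr_azim :: "nat \<Rightarrow> nat \<Rightarrow> real"
  path_coeff :: "nat \<Rightarrow> nat \<Rightarrow> complex"

definition wave_vector :: "real \<Rightarrow> real \<Rightarrow> point" where
  "wave_vector \<theta> \<phi> = (cos \<theta> * cos \<phi>, cos \<theta> * sin \<phi>, sin \<theta>)"

definition dep_wave :: "channel \<Rightarrow> nat \<Rightarrow> nat \<Rightarrow> point" where
  "dep_wave ch \<tau> l = wave_vector (dep_elev ch \<tau> l) (dep_azim ch \<tau> l)"

definition arr_wave :: "channel \<Rightarrow> nat \<Rightarrow> nat \<Rightarrow> point" where
  "arr_wave ch \<tau> l = wave_vector (arr_elev ch \<tau> l) (arr_azim ch \<tau> l)"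

definition tx_response :: "channel \<Rightarrow> nat \<Rightarrow> point \<Rightarrow> complex vec" where
  "tx_response ch \<tau> t = vec (paths ch \<tau>)
     (\<lambda>l. exp (\<i> * complex_of_real (2 * pi / wavelength ch * inner t (dep_wave ch \<tau> l))))"

definition rx_response :: "channel \<Rightarrow> nat \<Rightarrow> point \<Rightarrow> complex vec" where
  "rx_response ch \<tau> r = vec (paths ch \<tau>)
     (\<lambda>l. exp (\<i> * complex_of_real (2 * pi / wavelength ch * inner r (arr_wave ch \<tau> l))))"

definition coeff_vec :: "channel \<Rightarrow> nat \<Rightarrow> complex vec" where
  "coeff_vec ch \<tau> = vec (paths ch \<tau>) (path_coeff ch \<tau>)"

definition path_response_mat :: "channel \<Rightarrow> nat \<Rightarrow> complex mat" where
  "path_response_mat ch \<tau> = mat_diag (paths ch \<tau>) (\<lambda>l. coeff_vec ch \<tau> $ l)"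

definition impulse_response :: "channel \<Rightarrow> nat \<Rightarrow> point \<Rightarrow> point \<Rightarrow> complex" where
  "impulse_response ch \<tau> t r =
     scalar_prod (conjugate (rx_response ch \<tau> r)) (path_response_mat ch \<tau> *\<^sub>v tx_response ch \<tau> t)"

definition padded_response :: "channel \<Rightarrow> nat \<Rightarrow> point \<Rightarrow> point \<Rightarrow> complex vec" where
  "padded_response ch M t r =
     vec M (\<lambda>\<tau>. if \<tau> < taps ch then impulse_response ch \<tau> t r else 0)"

definition dft_mat :: "nat \<Rightarrow> complex mat" where
  "dft_mat M = mat M M
     (\<lambda>(m, n). exp (- (\<i> * complex_of_real (2 * pi * real m * real n / real M))))"

definition freq_response :: "channel \<Rightarrow> nat \<Rightarrow> point \<Rightarrow> point \<Rightarrow> complex vec" where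
  "freq_response ch M t r = dft_mat M *\<^sub>v padded_response ch M t r"

text \<open>The argument \<open>\<nu>\<close> is the noise power itself, i.e. the quantity usually written as \<open>\<sigma>\<close> squared.\<close>

definition rate ::
  "channel \<Rightarrow> nat \<Rightarrow> nat \<Rightarrow> real \<Rightarrow> point \<Rightarrow> point \<Rightarrow> real vec \<Rightarrow> real" where
  "rate ch M M_CP \<nu> t r p = 1 / real (M + M_CP) *
     (\<Sum>m<M. log 2 (1 + (cmod (freq_response ch M t r $ m))\<^sup>2 * p $ m / \<nu>))"

definition l1_norm :: "complex vec \<Rightarrow> real" where
  "l1_norm v = (\<Sum>i<dim_vec v. cmod (v $ i))"

definition channel_gain :: "channel \<Rightarrow> real" where
  "channel_gain ch = (\<Sum>\<tau><taps ch. (l1_norm (coeff_vec ch \<tau>))\<^sup>2)"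

text \<open>
  Linear independence over the rationals of the indexed family of first components
  of the departure wave vectors; in particular, no two entries may coincide.
\<close>

definition lia :: "channel \<Rightarrow> bool" where
  "lia ch \<longleftrightarrow> (\<forall>a :: nat \<Rightarrow> nat \<Rightarrow> rat.
     (\<exists>\<tau><taps ch. \<exists>l<paths ch \<tau>. a \<tau> l \<noteq> 0) \<longrightarrow>
     (\<Sum>\<tau><taps ch. \<Sum>l<paths ch \<tau>. of_rat (a \<tau> l) * fst (dep_wave ch \<tau> l)) \<noteq> 0)"

end

theory Submission
  imports Defs
begin

text \<open>
  Parseval and the triangle inequality give \<open>\<Sum>m. \<bar>c m\<bar>\<^sup>2 \<le> M G\<close>. Scale the gains and the
  powers to \<open>u m = \<bar>c m\<bar>\<^sup>2 / G\<close> and \<open>v m = M p m / P\<close>, so that both families sum to at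
  most \<open>M\<close> and the SNR of subcarrier \<open>m\<close> is \<open>a u m v m\<close> with \<open>a = G P / (M \<nu>)\<close>.
  For \<open>a \<ge> 8\<close> the function \<open>w \<mapsto> ln (1 + a w\<^sup>2)\<close> stays below its tangent at \<open>w = 1\<close> on the whole
  half-line \<open>w \<ge> 0\<close>; apply this at \<open>w = sqrt (u m v m) \<le> (u m + v m) / 2\<close> and sum over \<open>m\<close>.
\<close>

text \<open>Orthogonality of distinct DFT columns: the summand is \<open>w ^ m\<close> for an
  \<open>M\<close>-th root of unity \<open>w \<noteq> 1\<close>, so the geometric sum
  vanishes.\<close>

lemma sum_cis_eq_zero:
  fixes n k M :: nat
  assumes "n < M" "k < M" "n \<noteq> k"
  shows "(\<Sum>m<M. cis (- (2 * pi * real m * real n / real M))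
                 * cnj (cis (- (2 * pi * real m * real k / real M)))) = 0"
proof -
  define w where "w = cis (2 * pi * real k / real M - 2 * pi * real n / real M)"
  have summand: "cis (- (2 * pi * real m * real n / real M))
      * cnj (cis (- (2 * pi * real m * real k / real M))) = w ^ m" for m
    by (simp add: w_def Complex.DeMoivre cis_cnj cis_mult algebra_simps)
  have "w ^ M = cis (2 * pi * real k - 2 * pi * real n)"
    using assms by (simp add: w_def Complex.DeMoivre algebra_simps)
  also have "\<dots> = 1"
    by (simp add: cis_divide[symmetric] cis_multiple_2pi)
  finally have wM: "w ^ M = 1" .
  have "w \<noteq> 1"
  proof
    assume "w = 1"
    then have "cos (2 * pi * real k / real M - 2 * pi * real n / real M) = 1"
      unfolding w_def by (metis cis.sel(1) one_complex.sel(1))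
    then obtain i :: int where "2 * pi * real k / real M - 2 * pi * real n / real M = of_int i * 2 * pi"
      by (auto simp: cos_one_2pi_int)
    then have "pi * (real k - real n) = pi * (of_int i * real M)"
      using assms by (simp add: field_simps)
    then have "real_of_int (int k - int n) = of_int (i * int M)"
      by simp
    then have "int k - int n = i * int M"
      unfolding of_int_eq_iff .
    \<comment> \<open>Both indices lie below \<open>M\<close>, so congruence modulo \<open>M\<close>
      would force \<open>k = n\<close>.\<close>
    then have "int M dvd int k - int n"
      by simp
    then have "int k mod int M = int n mod int M"
      by (simp add: mod_eq_dvd_iff)
    with assms show False by simp
  qed
  then show ?thesis
    using wM by (simp add: summand geometric_sum)
qed

text \<open>Expanding the squared moduli gives a double sum over \<open>n\<close> and
  \<open>k\<close>, of which column orthogonality keeps only the diagonal. The factor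
  \<open>M\<close> is the squared norm of a column of the unnormalized DFT.\<close>

lemma dft_parseval:
  fixes h :: "nat \<Rightarrow> complex"
  shows "(\<Sum>m<M. (cmod (\<Sum>n<M. cis (- (2 * pi * real m * real n / real M)) * h n))\<^sup>2)
    = real M * (\<Sum>n<M. (cmod (h n))\<^sup>2)"
proof -
  let ?e = "\<lambda>m n. cis (- (2 * pi * real m * real n / real M))"
  have ee: "(\<Sum>m<M. ?e m n * cnj (?e m k)) = (if k = n then of_nat M else 0)"
    if "n < M" "k < M" for n k
    using that sum_cis_eq_zero[of n M k] by (auto simp: cis_cnj cis_mult)
  \<comment> \<open>The computation runs over the complex numbers, where a squared modulus is the
    product of a number and its conjugate.\<close>
  have "complex_of_real (\<Sum>m<M. (cmod (\<Sum>n<M. ?e m n * h n))\<^sup>2)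
      = (\<Sum>m<M. \<Sum>n<M. \<Sum>k<M. h n * cnj (h k) * (?e m n * cnj (?e m k)))"
    by (simp add: complex_norm_square sum_product mult_ac
        flip: of_real_power del: cis_cnj)
  also have "\<dots> = (\<Sum>n<M. \<Sum>k<M. h n * cnj (h k) * (\<Sum>m<M. ?e m n * cnj (?e m k)))"
    unfolding sum_distrib_left by (subst sum.swap, rule sum.cong[OF refl], rule sum.swap)
  also have "\<dots> = (\<Sum>n<M. \<Sum>k<M. if k = n then of_nat M * (h n * cnj (h k)) else 0)"
    by (intro sum.cong refl) (simp add: ee)
  also have "\<dots> = complex_of_real (real M * (\<Sum>n<M. (cmod (h n))\<^sup>2))"
    by (simp add: complex_norm_square sum_distrib_left flip: of_real_power)
  finally show ?thesis
    unfolding of_real_eq_iff .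
qed

text \<open>The path matrix is diagonal, so the tap is a sum of path coefficients, each multiplied
  by two phases of modulus 1; the triangle inequality does the rest.\<close>

lemma cmod_impulse_response_le:
  "cmod (impulse_response ch \<tau> t r) \<le> l1_norm (coeff_vec ch \<tau>)"
proof -
  let ?L = "paths ch \<tau>"
  have "path_response_mat ch \<tau> *\<^sub>v tx_response ch \<tau> t
      = vec ?L (\<lambda>l. path_coeff ch \<tau> l * tx_response ch \<tau> t $ l)"
    by (rule eq_vecI)
      (auto simp: path_response_mat_def mat_diag_def scalar_prod_def coeff_vec_def
        tx_response_def if_distrib[of "\<lambda>x. x * _"] cong: if_cong)
  then have "impulse_response ch \<tau> t r = (\<Sum>l<?L. cnj (rx_response ch \<tau> r $ l)
      * (path_coeff ch \<tau> l * tx_response ch \<tau> t $ l))"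
    by (simp add: impulse_response_def scalar_prod_def atLeast0LessThan rx_response_def)
  also have "cmod \<dots> \<le> (\<Sum>l<?L. cmod (path_coeff ch \<tau> l))"
    by (rule sum_norm_le)
      (simp add: norm_mult rx_response_def tx_response_def)
  finally show ?thesis
    by (simp add: l1_norm_def coeff_vec_def)
qed

lemma freq_response_nth:
  assumes "m < M"
  shows "freq_response ch M t r $ m
    = (\<Sum>n<M. cis (- (2 * pi * real m * real n / real M)) * padded_response ch M t r $ n)"
  using assms
  by (simp add: freq_response_def dft_mat_def padded_response_def scalar_prod_def
      atLeast0LessThan cis_conv_exp)

text \<open>Parseval reduces the claim to the energy of the padded response. As
  \<open>taps ch \<le> M\<close>, padding only appends zeros and cuts off no tap.\<close>

lemma sum_freq_response_le:
  assumes "taps ch \<le> M"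
  shows "(\<Sum>m<M. (cmod (freq_response ch M t r $ m))\<^sup>2) \<le> real M * channel_gain ch"
proof -
  have "(\<Sum>m<M. (cmod (freq_response ch M t r $ m))\<^sup>2)
      = real M * (\<Sum>n<M. (cmod (padded_response ch M t r $ n))\<^sup>2)"
    by (subst dft_parseval[symmetric]) (simp add: freq_response_nth)
  also have "(\<Sum>n<M. (cmod (padded_response ch M t r $ n))\<^sup>2)
      = (\<Sum>n<taps ch. (cmod (impulse_response ch n t r))\<^sup>2)"
    using assms by (intro sum.mono_neutral_cong_right) (auto simp: padded_response_def)
  also have "\<dots> \<le> channel_gain ch"
    unfolding channel_gain_def by (intro sum_mono power_mono cmod_impulse_response_le) auto
  finally show ?thesis by (simp add: mult_left_mono)
qed

text \<open>The gap \<open>f\<close> between tangent and function rises up to \<open>1 / a\<close>,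
  falls up to 1 and rises afterwards. Hence its minimum on the half-line is attained at 0 or at the
  point of tangency 1.\<close>

lemma ln_one_plus_square_le_tangent:
  fixes a w :: real
  assumes a: "a \<ge> 8" and w: "w \<ge> 0"
  shows "ln (1 + a * w\<^sup>2) \<le> ln (1 + a) + 2 * a / (1 + a) * (w - 1)"
proof -
  define f where "f x = ln (1 + a) + 2 * a / (1 + a) * (x - 1) - ln (1 + a * x\<^sup>2)" for x
  have pos: "1 + a * x\<^sup>2 > 0" for x
    using a by (intro add_pos_nonneg) auto
  \<comment> \<open>The derivative is put in factored form to expose its zeros \<open>1 / a\<close>
    and 1.\<close>
  define f' where "f' x = 2 * a * ((a * x - 1) * (x - 1)) / ((1 + a) * (1 + a * x\<^sup>2))" for x
  have f': "(f has_real_derivative f' x) (at x)" for x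
    unfolding f_def f'_def
    apply (rule derivative_eq_intros refl pos)+
    using a pos[of x] by (simp add: divide_simps) (simp add: algebra_simps power2_eq_square)
  have f1: "f 1 = 0"
    by (simp add: f_def)
  \<comment> \<open>The constant 8 originates here: the slope is at most 2, and
    \<open>ln (1 + a) \<ge> ln 9 \<ge> 2\<close> because \<open>exp 2 \<le> 9\<close>.\<close>
  have f0: "f 0 \<ge> 0"
  proof -
    have "exp 2 = exp 1 * exp (1::real)"
      by (simp flip: exp_add)
    also have "\<dots> \<le> 3 * 3"
      using exp_le by (intro mult_mono) auto
    finally have "2 \<le> ln (1 + a)"
      using a by (subst ln_ge_iff) auto
    moreover have "2 * a / (1 + a) \<le> 2"
      using a by (simp add: divide_simps)
    ultimately show ?thesis by (simp add: f_def)
  qed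
  have sgn: "f' x \<ge> 0" if "0 \<le> (a * x - 1) * (x - 1)" for x
    unfolding f'_def using a pos[of x] that
    by (intro divide_nonneg_pos mult_nonneg_nonneg[of "2 * a"] mult_pos_pos) auto
  have sgn': "f' x \<le> 0" if "(a * x - 1) * (x - 1) \<le> 0" for x
    unfolding f'_def using a pos[of x] that
    by (intro divide_nonpos_pos mult_nonneg_nonpos[of "2 * a"] mult_pos_pos) auto
  consider "a * w \<le> 1" | "a * w \<ge> 1" "w \<le> 1" | "w \<ge> 1" by linarith
  then have "f w \<ge> 0"
  proof cases
    case 1
    have "f 0 \<le> f w"
    proof (rule DERIV_nonneg_imp_nondecreasing[OF w])
      fix x assume x: "0 \<le> x" "x \<le> w"
      have "a * x \<le> a * w" using x a by (intro mult_left_mono) auto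
      \<comment> \<open>Together with \<open>a * x \<le> 1\<close> this gives
        \<open>x \<le> 1\<close>, so both factors of the numerator are nonpositive.\<close>
      moreover have "1 * x \<le> a * x" using x a by (intro mult_right_mono) auto
      ultimately have "f' x \<ge> 0" using 1 by (intro sgn mult_nonpos_nonpos) auto
      then show "\<exists>y. DERIV f x :> y \<and> 0 \<le> y" using f' by blast
    qed
    with f0 show ?thesis by simp
  next
    case 2
    have "f w \<ge> f 1"
    proof (rule DERIV_nonpos_imp_nonincreasing[OF 2(2)])
      fix x assume x: "w \<le> x" "x \<le> 1"
      have "a * w \<le> a * x" using x a by (intro mult_left_mono) auto
      then have "f' x \<le> 0" using 2 x by (intro sgn' mult_nonneg_nonpos) auto
      then show "\<exists>y. DERIV f x :> y \<and> y \<le> 0" using f' by blast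
    qed
    with f1 show ?thesis by simp
  next
    case 3
    have "f 1 \<le> f w"
    proof (rule DERIV_nonneg_imp_nondecreasing[OF 3])
      fix x :: real assume x: "1 \<le> x" "x \<le> w"
      have "1 * x \<le> a * x" using x a by (intro mult_right_mono) auto
      with x have "1 \<le> a * x" by linarith
      then have "f' x \<ge> 0" using x by (intro sgn mult_nonneg_nonneg) auto
      then show "\<exists>y. DERIV f x :> y \<and> 0 \<le> y" using f' by blast
    qed
    with f1 show ?thesis by simp
  qed
  then show ?thesis by (simp add: f_def)
qed

text \<open>The tangent bound at the geometric mean of \<open>u i\<close> and \<open>v i\<close>,
  followed by AM-GM, is linear in both families. After summation the linear term is nonpositive by
  the two budgets.\<close>

lemma sum_ln_one_plus_prod_le:
  fixes u v :: "'a \<Rightarrow> real"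
  assumes a: "a \<ge> 8"
    and u: "\<And>i. i \<in> I \<Longrightarrow> u i \<ge> 0" "sum u I \<le> real (card I)"
    and v: "\<And>i. i \<in> I \<Longrightarrow> v i \<ge> 0" "sum v I \<le> real (card I)"
  shows "(\<Sum>i\<in>I. ln (1 + a * (u i * v i))) \<le> real (card I) * ln (1 + a)"
proof -
  let ?c = "2 * a / (1 + a)"
  have c: "?c \<ge> 0" using a by simp
  have "ln (1 + a * (u i * v i)) \<le> ln (1 + a) + ?c * ((u i + v i) / 2 - 1)" if i: "i \<in> I" for i
  proof -
    have "ln (1 + a * (u i * v i)) \<le> ln (1 + a) + ?c * (sqrt (u i * v i) - 1)"
      using ln_one_plus_square_le_tangent[OF a, of "sqrt (u i * v i)"] u(1)[OF i] v(1)[OF i] by simp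
    also have "\<dots> \<le> ln (1 + a) + ?c * ((u i + v i) / 2 - 1)"
      using arith_geo_mean_sqrt[OF u(1)[OF i] v(1)[OF i]] c
      by (intro add_left_mono mult_left_mono) auto
    finally show ?thesis .
  qed
  then have "(\<Sum>i\<in>I. ln (1 + a * (u i * v i)))
      \<le> (\<Sum>i\<in>I. ln (1 + a) + ?c * ((u i + v i) / 2 - 1))"
    by (rule sum_mono)
  also have "\<dots> = real (card I) * ln (1 + a) + ?c * ((sum u I + sum v I) / 2 - real (card I))"
    by (simp only: sum.distrib sum_distrib_left[symmetric] sum_subtractf
        sum_divide_distrib[symmetric]) simp
  also have "\<dots> \<le> real (card I) * ln (1 + a)"
    using mult_nonneg_nonpos[OF c, of "(sum u I + sum v I) / 2 - real (card I)"] u(2) v(2) by simp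
  finally show ?thesis .
qed

theorem theorem2:
  fixes ch :: channel
    and M M_CP :: nat
    and P :: real
    and yt_min yt_max zt_min zt_max :: real
    and xr_min xr_max yr_min yr_max zr_min zr_max :: real
    and C_t C_r :: "point set"
  assumes "wavelength ch > 0"
    and "taps ch \<ge> 1"
    and "\<And>\<tau>. \<tau> < taps ch \<Longrightarrow> paths ch \<tau> \<ge> 1"
    and "M \<ge> taps ch"
    and "M_CP \<ge> taps ch"
    and "P > 0"
    and "yt_min \<le> yt_max" and "zt_min \<le> zt_max"
    and "C_t = UNIV \<times> {yt_min..yt_max} \<times> {zt_min..zt_max}"
    and "xr_min \<le> xr_max" and "yr_min \<le> yr_max" and "zr_min \<le> zr_max"
    and "C_r = {xr_min..xr_max} \<times> {yr_min..yr_max} \<times> {zr_min..zr_max}"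
    and "lia ch"
  shows "\<exists>\<nu>\<^sub>0>0. \<forall>\<nu>. 0 < \<nu> \<and> \<nu> \<le> \<nu>\<^sub>0 \<longrightarrow>
    (\<forall>t\<in>C_t. \<forall>r\<in>C_r. \<forall>p\<in>carrier_vec M.
      (\<forall>m<M. p $ m \<ge> 0) \<and> (\<Sum>m<M. p $ m) \<le> P \<longrightarrow>
      rate ch M M_CP \<nu> t r p
        \<le> real M / real (M + M_CP) * log 2 (1 + channel_gain ch * P / (real M * \<nu>)))"
proof -
  let ?G = "channel_gain ch"
  have M: "real M > 0" using assms by auto
  have P: "P > 0" by fact
  have G: "?G \<ge> 0"
    unfolding channel_gain_def by (intro sum_nonneg) auto
  \<comment> \<open>For positive gain this is the noise power at which
    \<open>G * P / (M * \<nu>)\<close> equals 8. For zero gain that formula would give 0, and 1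
    serves as an arbitrary positive value.\<close>
  define \<nu>\<^sub>0 where "\<nu>\<^sub>0 = (if ?G = 0 then 1 else ?G * P / (8 * real M))"
  have "\<nu>\<^sub>0 > 0"
    using G P M by (auto simp: \<nu>\<^sub>0_def)
  moreover have "rate ch M M_CP \<nu> t r p
      \<le> real M / real (M + M_CP) * log 2 (1 + ?G * P / (real M * \<nu>))"
    if \<nu>: "0 < \<nu>" "\<nu> \<le> \<nu>\<^sub>0" and p: "\<And>m. m < M \<Longrightarrow> p $ m \<ge> 0" "(\<Sum>m<M. p $ m) \<le> P"
    for \<nu> t r and p :: "real vec"
  proof -
    define g where "g m = (cmod (freq_response ch M t r $ m))\<^sup>2" for m
    define a where "a = ?G * P / (real M * \<nu>)"
    have g: "g m \<ge> 0" for m by (simp add: g_def)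
    have sum_g: "(\<Sum>m<M. g m) \<le> real M * ?G"
      unfolding g_def by (rule sum_freq_response_le) fact
    have "(\<Sum>m<M. ln (1 + g m * p $ m / \<nu>)) \<le> real M * ln (1 + a)"
    \<comment> \<open>Normalizing by \<open>?G\<close> requires it to be nonzero. If it is zero, all
      subcarrier gains vanish and both sides are 0.\<close>
    proof (cases "?G = 0")
      case True
      then have "(\<Sum>m<M. g m) = 0"
        using sum_g by (intro antisym sum_nonneg) (auto simp: g)
      then have "\<forall>m<M. g m = 0"
        by (subst (asm) sum_nonneg_eq_0_iff) (auto simp: g)
      then show ?thesis using True by (simp add: a_def)
    next
      case False
      with G have Gpos: "?G > 0" by simp
      have "\<nu> * (8 * real M) \<le> ?G * P"
        using \<nu> False M by (simp add: \<nu>\<^sub>0_def pos_le_divide_eq)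
      then have "a \<ge> 8"
        using M \<nu> by (simp add: a_def pos_le_divide_eq algebra_simps)
      moreover have "(\<Sum>m<M. g m / ?G) \<le> real M"
        using sum_g Gpos by (simp add: sum_divide_distrib[symmetric] pos_divide_le_eq)
      moreover have "(\<Sum>m<M. real M * p $ m / P) \<le> real M"
        using p(2) P M by (simp add: sum_divide_distrib[symmetric] sum_distrib_left[symmetric]
            pos_divide_le_eq)
      ultimately have "(\<Sum>m<M. ln (1 + a * (g m / ?G * (real M * p $ m / P)))) \<le> real M * ln (1 + a)"
        using sum_ln_one_plus_prod_le[of a "{..<M}" "\<lambda>m. g m / ?G" "\<lambda>m. real M * p $ m / P"]
          g G P p(1) by simp
      \<comment> \<open>The normalizations cancel against \<open>a\<close>, which recovers the
        actual SNR of the subcarrier.\<close>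
      moreover have "a * (g m / ?G * (real M * p $ m / P)) = g m * p $ m / \<nu>" for m
        using Gpos P M \<nu> by (simp add: a_def field_simps)
      ultimately show ?thesis by simp
    qed
    then have "(\<Sum>m<M. log 2 (1 + g m * p $ m / \<nu>)) \<le> real M * log 2 (1 + a)"
      by (simp add: log_def sum_divide_distrib[symmetric] divide_right_mono)
    then have "1 / real (M + M_CP) * (\<Sum>m<M. log 2 (1 + g m * p $ m / \<nu>))
        \<le> 1 / real (M + M_CP) * (real M * log 2 (1 + a))"
      by (rule mult_left_mono) simp
    then show ?thesis
      by (simp add: rate_def g_def a_def)
  qed
  ultimately show ?thesis by blast
qed

end
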